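(* Let $f:\mathbb{R}^\ell\times\mathbb{R}^m\to\mathbb{R}^\ell$ be $C^1$, let $\Lambda$ be a parameter shift with limits $\lambda_\pm$, and let $X$ define a stable path. For $s\in\mathbb{R}$ and $n\in\mathbb{N}$ let $B_n(s)=[D_xf(X(s),\Lambda(s))]^n$. Then there are constants $\kappa>0$ and $c\in(0,1)$ such that $\|B_n(s)\|<\kappa c^n$ for every $s\in\mathbb{R}$ and $n\in\mathbb{N}$, where $\|\cdot\|$ is the matrix norm induced by the Euclidean norm.
   Context: A parameter shift is a $C^1$ function $\Lambda:\mathbb{R}\to\mathbb{R}^m$ with $\lim_{s\to\pm\infty}\Lambda(s)=\lambda_\pm$ and $\lim_{s\to\pm\infty}\Lambda'(s)=0$. A stable path is given by $X:\mathbb{R}\to\mathbb{R}^\ell$ such that: $X(s)$ is a fixed point of $f(\cdot,\Lambda(s))$ for every $s$; $\{(s,X(s))\}$ is a connected curve; the limits $X_\pm=\lim_{s\to\pm\infty}X(s)$ exist and are fixed points of $f(\cdot,\lambda_\pm)$; and the spectral radius of $D_xf(X(s),\Lambda(s))$ is $<1$ for all $s\in\mathbb{R}\cup\{\pm\infty\}$ (with $X(\pm\infty)=X_\pm$, $\Lambda(\pm\infty)=\lambda_\pm$). *)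

theory Defs
  imports "HOL-Analysis.Analysis"
begin

text \<open>Continuously differentiable maps between Euclidean spaces: a Frechet derivative
  exists everywhere and depends continuously (in operator norm) on the point.\<close>
definition C1 :: "('a::euclidean_space \<Rightarrow> 'b::euclidean_space) \<Rightarrow> bool" where
  "C1 g \<longleftrightarrow> (\<exists>g' :: 'a \<Rightarrow> ('a \<Rightarrow>\<^sub>L 'b).
      (\<forall>z. (g has_derivative blinfun_apply (g' z)) (at z)) \<and> continuous_on UNIV g')"

text \<open>Matrix powers (for matrices, the ring power on vec is componentwise, so we define it).\<close>
fun matpow :: "real^'n^'n \<Rightarrow> nat \<Rightarrow> real^'n^'n" where
  "matpow A 0 = mat 1"
| "matpow A (Suc n) = A ** matpow A n"

text \<open>Spectral radius of a real square matrix: the maximal modulus of its (complex) eigenvalues.\<close>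
definition cx_eigenvalue :: "real^'n^'n \<Rightarrow> complex \<Rightarrow> bool" where
  "cx_eigenvalue A z \<longleftrightarrow>
     (\<exists>v :: complex^'n. v \<noteq> 0 \<and> (\<chi> i j. complex_of_real (A $ i $ j)) *v v = z *s v)"

definition spectral_radius :: "real^'n^'n \<Rightarrow> real" where
  "spectral_radius A = Max {cmod z | z. cx_eigenvalue A z}"

text \<open>Partial Jacobian D_x f(x,p) as an l x l matrix.\<close>
definition Dx :: "((real^'l) \<times> (real^'m) \<Rightarrow> real^'l) \<Rightarrow> real^'l \<Rightarrow> real^'m \<Rightarrow> real^'l^'l" where
  "Dx f x p = matrix (frechet_derivative (\<lambda>y. f (y, p)) (at x))"

definition parameter_shift :: "(real \<Rightarrow> real^'m) \<Rightarrow> real^'m \<Rightarrow> real^'m \<Rightarrow> bool" where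
  "parameter_shift \<Lambda> lm lp \<longleftrightarrow>
     (\<exists>\<Lambda>'. (\<forall>s. (\<Lambda> has_vector_derivative \<Lambda>' s) (at s)) \<and> continuous_on UNIV \<Lambda>' \<and>
        (\<Lambda> \<longlongrightarrow> lm) at_bot \<and> (\<Lambda> \<longlongrightarrow> lp) at_top \<and>
        (\<Lambda>' \<longlongrightarrow> 0) at_bot \<and> (\<Lambda>' \<longlongrightarrow> 0) at_top)"

definition stable_path ::
  "((real^'l) \<times> (real^'m) \<Rightarrow> real^'l) \<Rightarrow> (real \<Rightarrow> real^'m) \<Rightarrow> real^'m \<Rightarrow> real^'m
     \<Rightarrow> (real \<Rightarrow> real^'l) \<Rightarrow> bool" where
  "stable_path f \<Lambda> lm lp X \<longleftrightarrow>
     (\<forall>s. f (X s, \<Lambda> s) = X s) \<and>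
     connected (range (\<lambda>s. (s, X s))) \<and>
     (\<exists>Xm Xp. (X \<longlongrightarrow> Xm) at_bot \<and> (X \<longlongrightarrow> Xp) at_top \<and>
        f (Xm, lm) = Xm \<and> f (Xp, lp) = Xp \<and>
        spectral_radius (Dx f Xm lm) < 1 \<and> spectral_radius (Dx f Xp lp) < 1) \<and>
     (\<forall>s. spectral_radius (Dx f (X s) (\<Lambda> s)) < 1)"

end

(*
  Spectral radius < 1 gives exponential decay of the powers of a single matrix (via its
  Jordan normal form), and this decay is an open condition: if |A^N| < 1/4 then |B^N| <= 1/2
  for all B near A, which forces |B^n| <= K c^n with c = (1/2)^(1/N). Hence the decay is
  uniform on every compact set of such matrices. Along the path, the matrices
  D_x f(X s, Lambda s) stay near the two limiting matrices for |s| large, and form a compact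
  set on the remaining bounded interval -- provided X is continuous.

  Continuity of X is not assumed, only connectedness of its graph. Since 1 is never an
  eigenvalue of D_x f along the path, the implicit function theorem turns the fixed points of
  f(., Lambda s) near each point of the graph into a continuous local branch; continuing such
  branches along segments and using connectedness of the graph shows that X follows them.
*)

theory Submission
  imports Defs "Jordan_Normal_Form.Spectral_Radius"
begin

no_notation Matrix.vec_index (infixl "$" 100)

section \<open>Matrix powers and the operator norm\<close>

lemma matpow_Suc_right: "matpow A (Suc k) = matpow A k ** A"
  by (induction k) (simp_all add: matrix_mul_assoc)

lemma matpow_add: "matpow A (m + n) = matpow A m ** matpow A n"
  by (induction m) (simp_all add: matrix_mul_assoc)

lemma matpow_mult: "matpow A (m * n) = matpow (matpow A m) n"
  by (induction n) (simp_all add: matpow_add)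

lemma matpow_scaleR: "matpow (c *\<^sub>R A) k = c ^ k *\<^sub>R matpow A k"
  by (induction k) (simp_all add: matrix_scalar_ac scalar_matrix_assoc[symmetric])

lemma matpow_mult_fixed_vector: "A *v v = v \<Longrightarrow> matpow A k *v v = v"
  by (induction k) (simp_all add: matrix_vector_mul_assoc[symmetric])

lemma tendsto_matrix_mult:
  fixes f g :: "'a \<Rightarrow> real^'n::finite^'n"
  assumes "(f \<longlongrightarrow> a) F" "(g \<longlongrightarrow> b) F"
  shows "((\<lambda>x. f x ** g x) \<longlongrightarrow> a ** b) F"
  unfolding matrix_matrix_mult_def
  by (intro tendsto_vec_lambda tendsto_sum tendsto_mult tendsto_vec_nth assms)

lemma tendsto_matpow:
  fixes f :: "'a \<Rightarrow> real^'n::finite^'n"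
  assumes "(f \<longlongrightarrow> a) F"
  shows "((\<lambda>x. matpow (f x) k) \<longlongrightarrow> matpow a k) F"
  by (induction k) (simp_all add: tendsto_matrix_mult assms)

lemma onorm_matrix_nonneg: "0 \<le> onorm ((*v) (A::real^'n::finite^'m::finite))"
  by (rule onorm_pos_le) (rule matrix_vector_mul_bounded_linear)

lemma onorm_matrix_mult_le:
  "onorm ((*v) (A ** B)) \<le> onorm ((*v) (A::real^'n::finite^'m::finite)) * onorm ((*v) (B::real^'k::finite^'n))"
proof -
  have "(*v) (A ** B) = (*v) A \<circ> (*v) B"
    by (auto simp: matrix_vector_mul_assoc)
  then show ?thesis
    by (simp add: onorm_compose matrix_vector_mul_bounded_linear)
qed

lemma onorm_matrix_le_dist:
  fixes A B :: "real^'n::finite^'m::finite"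
  shows "onorm ((*v) A) \<le> onorm ((*v) B) + real CARD('m) * real CARD('n) * dist A B"
proof -
  have "\<bar>(A - B) $ i $ j\<bar> \<le> dist A B" for i j
    using component_le_norm_cart[of "(A - B) $ i" j] Finite_Cartesian_Product.norm_nth_le[of "A - B" i]
    by (simp add: dist_norm)
  then have "onorm ((*v) (A - B)) \<le> real CARD('m) * real CARD('n) * dist A B"
    by (rule onorm_le_matrix_component)
  moreover have "(*v) A = (\<lambda>x. B *v x + (A - B) *v x)"
    by (auto simp: matrix_vector_mult_diff_rdistrib)
  then have "onorm ((*v) A) \<le> onorm ((*v) B) + onorm ((*v) (A - B))"
    using onorm_triangle[OF matrix_vector_mul_bounded_linear matrix_vector_mul_bounded_linear] by simp
  ultimately show ?thesis
    by linarith
qed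

lemma onorm_matpow_le: "onorm ((*v) (matpow A n)) \<le> onorm ((*v) (A::real^'n::finite^'n)) ^ n"
proof (induction n)
  case 0
  have "(*v) (Finite_Cartesian_Product.mat 1 :: real^'n^'n) = (\<lambda>x. x)"
    by auto
  then show ?case
    using onorm_id_le by simp
next
  case (Suc n)
  have "onorm ((*v) (matpow A (Suc n))) \<le> onorm ((*v) A) * onorm ((*v) (matpow A n))"
    using onorm_matrix_mult_le by simp
  also have "\<dots> \<le> onorm ((*v) A) * onorm ((*v) A) ^ n"
    by (rule mult_left_mono[OF Suc onorm_matrix_nonneg])
  finally show ?case
    by simp
qed

lemma onorm_matpow_le_if_power_halves:
  fixes A :: "real^'n::finite^'n"
  assumes N: "0 < N" and half: "onorm ((*v) (matpow A N)) \<le> 1/2"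
    and R: "onorm ((*v) A) \<le> R" "1 \<le> R"
  shows "onorm ((*v) (matpow A n)) \<le> 2 * R ^ N * root N (1/2) ^ n"
proof -
  define c where "c = root N (1/2)"
  have c: "0 < c" "c < 1" "c ^ N = 1/2"
    using N by (simp_all add: c_def real_root_pow_pos)
  define q j where "q = n div N" and "j = n mod N"
  have n: "n = N * q + j" and "j < N"
    using N by (simp_all add: q_def j_def)
  have "onorm ((*v) (matpow A n)) \<le> onorm ((*v) (matpow A (N * q))) * onorm ((*v) (matpow A j))"
    unfolding n matpow_add by (rule onorm_matrix_mult_le)
  also have "\<dots> \<le> (1/2) ^ q * R ^ N"
  proof (rule mult_mono)
    have "onorm ((*v) (matpow A (N * q))) \<le> onorm ((*v) (matpow A N)) ^ q"
      unfolding matpow_mult by (rule onorm_matpow_le)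
    also have "\<dots> \<le> (1/2) ^ q"
      by (rule power_mono[OF half onorm_matrix_nonneg])
    finally show "onorm ((*v) (matpow A (N * q))) \<le> (1/2) ^ q" .
    have "onorm ((*v) (matpow A j)) \<le> R ^ j"
      using onorm_matpow_le power_mono[OF R(1) onorm_matrix_nonneg] order_trans by blast
    also have "\<dots> \<le> R ^ N"
      using \<open>j < N\<close> R(2) by (simp add: power_increasing)
    finally show "onorm ((*v) (matpow A j)) \<le> R ^ N" .
  qed (simp_all add: onorm_matrix_nonneg)
  also have "\<dots> \<le> 2 * R ^ N * c ^ n"
  proof -
    have "c ^ N \<le> c ^ j"
      using c \<open>j < N\<close> by (simp add: power_decreasing)
    then have "1/2 \<le> c ^ j"
      using c by simp
    then have "(1/2) ^ q \<le> 2 * c ^ n"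
      by (simp add: n power_add power_mult c)
    then show ?thesis
      using R(2) by (simp add: mult.commute mult_right_mono)
  qed
  finally show ?thesis
    by (simp add: c_def)
qed

section \<open>Uniform exponential stability\<close>

definition uniformly_exp_stable :: "(real^'n^'n) set \<Rightarrow> bool" where
  "uniformly_exp_stable S \<longleftrightarrow>
     (\<exists>K c. 0 < c \<and> c < 1 \<and> (\<forall>A\<in>S. \<forall>k. onorm ((*v) (matpow A k)) \<le> K * c ^ k))"

lemma uniformly_exp_stableI:
  "0 < c \<Longrightarrow> c < 1 \<Longrightarrow> (\<And>A k. A \<in> S \<Longrightarrow> onorm ((*v) (matpow A k)) \<le> K * c ^ k)
    \<Longrightarrow> uniformly_exp_stable S"
  unfolding uniformly_exp_stable_def by blast

lemma uniformly_exp_stable_subset: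
  "uniformly_exp_stable T \<Longrightarrow> S \<subseteq> T \<Longrightarrow> uniformly_exp_stable S"
  unfolding uniformly_exp_stable_def by blast

lemma uniformly_exp_stable_Un:
  assumes "uniformly_exp_stable S" "uniformly_exp_stable T"
  shows "uniformly_exp_stable (S \<union> T)"
proof -
  obtain K1 c1 K2 c2 where c: "0 < c1" "c1 < 1" "0 < c2" "c2 < 1"
    and S: "\<And>A k. A \<in> S \<Longrightarrow> onorm ((*v) (matpow A k)) \<le> K1 * c1 ^ k"
    and T: "\<And>A k. A \<in> T \<Longrightarrow> onorm ((*v) (matpow A k)) \<le> K2 * c2 ^ k"
    using assms unfolding uniformly_exp_stable_def by meson
  have weaken: "onorm ((*v) (matpow A k)) \<le> max K1 K2 * max c1 c2 ^ k"
    if "onorm ((*v) (matpow A k)) \<le> K' * c' ^ k" "K' \<le> max K1 K2" "0 < c'" "c' \<le> max c1 c2"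
    for A k K' c'
  proof -
    have "0 \<le> K' * c' ^ k"
      using that(1) onorm_matrix_nonneg order_trans by blast
    then have "0 \<le> K'"
      using zero_less_power[OF \<open>0 < c'\<close>, of k] by (simp add: zero_le_mult_iff)
    then have "K' * c' ^ k \<le> max K1 K2 * max c1 c2 ^ k"
      using that by (intro mult_mono power_mono) auto
    with that(1) show ?thesis
      by linarith
  qed
  show ?thesis
  proof (rule uniformly_exp_stableI)
    show "0 < max c1 c2" "max c1 c2 < 1"
      using c by auto
    show "onorm ((*v) (matpow A k)) \<le> max K1 K2 * max c1 c2 ^ k" if "A \<in> S \<union> T" for A k
      using that weaken[OF S] weaken[OF T] c by auto
  qed
qed

lemma uniformly_exp_stable_UN:
  "finite I \<Longrightarrow> (\<And>i. i \<in> I \<Longrightarrow> uniformly_exp_stable (S i)) \<Longrightarrow> uniformly_exp_stable (\<Union>i\<in>I. S i)"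
proof (induction I rule: finite_induct)
  case empty
  show ?case
    by (rule uniformly_exp_stableI[of "1/2"]) simp_all
next
  case (insert i I)
  then show ?case
    by (simp add: uniformly_exp_stable_Un)
qed

lemma uniformly_exp_stable_small_power:
  assumes "uniformly_exp_stable {A}" and "\<epsilon> > 0"
  obtains N where "N > 0" "onorm ((*v) (matpow A N)) < \<epsilon>"
proof -
  obtain K r where r: "0 < r" "r < 1" and K: "\<And>k. onorm ((*v) (matpow A k)) \<le> K * r ^ k"
    using assms(1) unfolding uniformly_exp_stable_def by blast
  have "(\<lambda>k. K * r ^ k) \<longlonglongrightarrow> 0"
    using r by (intro tendsto_mult_right_zero LIMSEQ_power_zero) simp
  then have "eventually (\<lambda>k. K * r ^ k < \<epsilon>) sequentially"
    using assms(2) by (rule order_tendstoD(2))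
  then obtain N0 where N0: "\<And>k. k \<ge> N0 \<Longrightarrow> K * r ^ k < \<epsilon>"
    unfolding eventually_sequentially by blast
  have "onorm ((*v) (matpow A (Suc N0))) < \<epsilon>"
    using K[of "Suc N0"] N0[OF le_SucI[OF order_refl]] by linarith
  then show thesis
    by (rule that[rotated]) simp
qed

text \<open>Exponential stability is an open condition: a power \<open>A\<^sub>0^N\<close> of norm below \<open>1/4\<close>
  keeps norm at most \<open>1/2\<close> nearby.\<close>
lemma uniformly_exp_stable_ball:
  fixes A0 :: "real^'n::finite^'n"
  assumes "uniformly_exp_stable {A0}"
  obtains \<epsilon> where "\<epsilon> > 0" "uniformly_exp_stable (ball A0 \<epsilon>)"
proof -
  obtain N where "N > 0" and N: "onorm ((*v) (matpow A0 N)) < 1/4"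
    by (rule uniformly_exp_stable_small_power[OF assms, of "1/4"]) auto
  define n2 where "n2 = real CARD('n) * real CARD('n)"
  have "0 < n2"
    by (simp add: n2_def)
  have "isCont (\<lambda>A. matpow A N) A0"
    unfolding isCont_def by (rule tendsto_matpow[OF tendsto_ident_at])
  moreover have "1 / (4 * n2) > 0"
    using \<open>0 < n2\<close> by simp
  ultimately obtain d where d: "d > 0"
    and dN: "\<And>A. dist A A0 < d \<Longrightarrow> dist (matpow A N) (matpow A0 N) < 1 / (4 * n2)"
    unfolding continuous_at_eps_delta by blast
  define R where "R = max 1 (onorm ((*v) A0) + n2)"
  have "uniformly_exp_stable (ball A0 (min d 1))"
  proof (rule uniformly_exp_stableI)
    fix A k assume "A \<in> ball A0 (min d 1)"
    then have A: "dist A A0 < d" "dist A A0 < 1"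
      by (simp_all add: dist_commute)
    have "n2 * dist (matpow A N) (matpow A0 N) < 1/4"
      using dN[OF A(1)] \<open>0 < n2\<close> by (simp add: field_simps)
    then have "onorm ((*v) (matpow A N)) \<le> 1/2"
      using onorm_matrix_le_dist[of "matpow A N" "matpow A0 N", folded n2_def] N by linarith
    moreover have "n2 * dist A A0 \<le> n2"
      using A(2) \<open>0 < n2\<close> by simp
    then have "onorm ((*v) A) \<le> R"
      using onorm_matrix_le_dist[of A A0, folded n2_def] unfolding R_def by linarith
    ultimately show "onorm ((*v) (matpow A k)) \<le> 2 * R ^ N * root N (1/2) ^ k"
      by (rule onorm_matpow_le_if_power_halves[OF \<open>N > 0\<close>]) (simp add: R_def)
  qed (use \<open>N > 0\<close> in simp_all)
  with d show thesis
    by (intro that[of "min d 1"]) simp_all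
qed

lemma uniformly_exp_stable_compact:
  fixes S :: "(real^'n::finite^'n) set"
  assumes "compact S" and stable: "\<And>A. A \<in> S \<Longrightarrow> uniformly_exp_stable {A}"
  shows "uniformly_exp_stable S"
proof -
  have "\<exists>\<epsilon>. \<epsilon> > 0 \<and> uniformly_exp_stable (ball A \<epsilon>)" if "A \<in> S" for A
    using uniformly_exp_stable_ball[OF stable[OF that]] by blast
  then obtain \<epsilon> where \<epsilon>: "\<And>A. A \<in> S \<Longrightarrow> \<epsilon> A > 0 \<and> uniformly_exp_stable (ball A (\<epsilon> A))"
    using bchoice[of S "\<lambda>A \<epsilon>. \<epsilon> > 0 \<and> uniformly_exp_stable (ball A \<epsilon>)"] by blast
  then have "S \<subseteq> (\<Union>A\<in>S. ball A (\<epsilon> A))"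
    by force
  then obtain C where C: "C \<subseteq> S" "finite C" "S \<subseteq> (\<Union>A\<in>C. ball A (\<epsilon> A))"
    by (rule compactE_image[OF \<open>compact S\<close> open_ball])
  then have "uniformly_exp_stable (\<Union>A\<in>C. ball A (\<epsilon> A))"
    using \<epsilon> by (intro uniformly_exp_stable_UN) auto
  then show ?thesis
    using C(3) by (rule uniformly_exp_stable_subset)
qed

lemma uniformly_exp_stable_fixed_vector:
  assumes "uniformly_exp_stable {A}" and "A *v v = v"
  shows "v = 0"
proof -
  obtain k where k: "onorm ((*v) (matpow A k)) < 1"
    using uniformly_exp_stable_small_power[OF assms(1), of 1] by auto
  have "norm v = norm (matpow A k *v v)"
    by (simp add: matpow_mult_fixed_vector[OF assms(2)])
  also have "\<dots> \<le> onorm ((*v) (matpow A k)) * norm v"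
    by (rule onorm) (rule matrix_vector_mul_bounded_linear)
  finally have "(1 - onorm ((*v) (matpow A k))) * norm v \<le> 0"
    by (simp add: algebra_simps)
  with k show ?thesis
    by (simp add: mult_le_0_iff)
qed

lemma uniformly_exp_stable_range:
  fixes A :: "real \<Rightarrow> real^'n::finite^'n"
  assumes "continuous_on UNIV A" and "(A \<longlongrightarrow> Am) at_bot" "(A \<longlongrightarrow> Ap) at_top"
    and "uniformly_exp_stable {Am}" "uniformly_exp_stable {Ap}"
    and "\<And>s. uniformly_exp_stable {A s}"
  shows "uniformly_exp_stable (range A)"
proof -
  obtain \<epsilon>m where \<epsilon>m: "\<epsilon>m > 0" "uniformly_exp_stable (ball Am \<epsilon>m)"
    by (rule uniformly_exp_stable_ball[OF assms(4)])
  obtain \<epsilon>p where \<epsilon>p: "\<epsilon>p > 0" "uniformly_exp_stable (ball Ap \<epsilon>p)"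
    by (rule uniformly_exp_stable_ball[OF assms(5)])
  obtain Tm where Tm: "\<And>s. s \<le> Tm \<Longrightarrow> A s \<in> ball Am \<epsilon>m"
    using tendstoD[OF assms(2) \<epsilon>m(1)] by (auto simp: eventually_at_bot_linorder dist_commute)
  obtain Tp where Tp: "\<And>s. s \<ge> Tp \<Longrightarrow> A s \<in> ball Ap \<epsilon>p"
    using tendstoD[OF assms(3) \<epsilon>p(1)] by (auto simp: eventually_at_top_linorder dist_commute)
  have "compact (A ` {Tm..Tp})"
    by (rule compact_continuous_image[OF continuous_on_subset[OF assms(1)]]) auto
  then have "uniformly_exp_stable (A ` {Tm..Tp})"
    using assms(6) by (blast intro: uniformly_exp_stable_compact)
  then have "uniformly_exp_stable (ball Am \<epsilon>m \<union> A ` {Tm..Tp} \<union> ball Ap \<epsilon>p)"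
    using \<epsilon>m(2) \<epsilon>p(2) by (intro uniformly_exp_stable_Un)
  moreover have "A s \<in> ball Am \<epsilon>m \<union> A ` {Tm..Tp} \<union> ball Ap \<epsilon>p" for s
    using Tm[of s] Tp[of s] by (cases "s \<le> Tm"; cases "Tp \<le> s") auto
  then have "range A \<subseteq> ball Am \<epsilon>m \<union> A ` {Tm..Tp} \<union> ball Ap \<epsilon>p"
    by blast
  ultimately show ?thesis
    by (rule uniformly_exp_stable_subset)
qed

section \<open>Spectral radius below one\<close>

text \<open>The Jordan normal form library works with matrices indexed by natural numbers;
  an enumeration \<open>e\<close> of the index type transports a matrix there.\<close>
definition complex_mat_of :: "(nat \<Rightarrow> 'n::finite) \<Rightarrow> real^'n^'n \<Rightarrow> complex mat" where
  "complex_mat_of e A = mat CARD('n) CARD('n) (\<lambda>(i, j). complex_of_real (A $ e i $ e j))"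

lemma complex_mat_of_carrier: "complex_mat_of e (A::real^'n::finite^'n) \<in> carrier_mat CARD('n) CARD('n)"
  by (simp add: complex_mat_of_def)

lemma dim_complex_mat_of [simp]:
  "dim_row (complex_mat_of e (A::real^'n::finite^'n)) = CARD('n)"
  "dim_col (complex_mat_of e (A::real^'n::finite^'n)) = CARD('n)"
  by (simp_all add: complex_mat_of_def)

context
  fixes e :: "nat \<Rightarrow> 'n::finite"
  assumes e: "bij_betw e {..<CARD('n)} UNIV"
begin

lemma sum_enum: "(\<Sum>k<CARD('n). g (e k)) = (\<Sum>j\<in>UNIV. g j)"
  using sum.reindex_bij_betw[OF e] .

lemma enum_inv_into:
  "e (inv_into {..<CARD('n)} e i) = i" "inv_into {..<CARD('n)} e i < CARD('n)"
  "k < CARD('n) \<Longrightarrow> inv_into {..<CARD('n)} e (e k) = k"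
  using e by (simp_all add: bij_betw_def f_inv_into_f inv_into_f_f)
    (metis UNIV_I inv_into_into lessThan_iff)

lemma complex_mat_of_mult: "complex_mat_of e (A ** B) = complex_mat_of e A * complex_mat_of e B"
proof (rule eq_matI)
  fix i j assume "i < dim_row (complex_mat_of e A * complex_mat_of e B)"
    and "j < dim_col (complex_mat_of e A * complex_mat_of e B)"
  then show "complex_mat_of e (A ** B) $$ (i, j) = (complex_mat_of e A * complex_mat_of e B) $$ (i, j)"
    using sum_enum[of "\<lambda>k. complex_of_real (A $ e i $ k) * complex_of_real (B $ k $ e j)"]
    by (simp add: complex_mat_of_def scalar_prod_def matrix_matrix_mult_def atLeast0LessThan)
qed (simp_all add: complex_mat_of_def)

lemma complex_mat_of_one: "complex_mat_of e (Finite_Cartesian_Product.mat 1) = 1\<^sub>m CARD('n)"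
proof (rule eq_matI)
  fix i j assume "i < dim_row (1\<^sub>m CARD('n))" "j < dim_col (1\<^sub>m CARD('n))"
  moreover from e have "i < CARD('n) \<Longrightarrow> j < CARD('n) \<Longrightarrow> e i = e j \<longleftrightarrow> i = j"
    by (auto simp: bij_betw_def inj_on_def)
  ultimately show "complex_mat_of e (Finite_Cartesian_Product.mat 1) $$ (i, j) = 1\<^sub>m CARD('n) $$ (i, j)"
    by (simp add: complex_mat_of_def Finite_Cartesian_Product.mat_def)
qed (simp_all add: complex_mat_of_def)

lemma complex_mat_of_matpow: "complex_mat_of e (matpow A k) = complex_mat_of e A ^\<^sub>m k"
proof (induction k)
  case 0
  show ?case by (simp add: complex_mat_of_one)
next
  case (Suc k)
  show ?case by (simp only: matpow_Suc_right complex_mat_of_mult Suc pow_mat.simps)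
qed

lemma eigenvalue_complex_mat_of_iff: "eigenvalue (complex_mat_of e A) z \<longleftrightarrow> cx_eigenvalue A z"
proof -
  let ?C = "(\<chi> i j. complex_of_real (A $ i $ j)) :: complex^'n^'n"
  let ?ei = "inv_into {..<CARD('n)} e"
  define to_jnf :: "complex^'n \<Rightarrow> complex Matrix.vec" where "to_jnf w = Matrix.vec CARD('n) (\<lambda>k. w $ e k)" for w
  define from_jnf :: "complex Matrix.vec \<Rightarrow> complex^'n" where "from_jnf v = (\<chi> i. Matrix.vec_index v (?ei i))" for v
  have of_to: "from_jnf (to_jnf w) = w" for w
    using enum_inv_into(1,2) by (simp add: from_jnf_def to_jnf_def Finite_Cartesian_Product.vec_eq_iff)
  have to_of: "to_jnf (from_jnf v) = v" if "v \<in> carrier_vec CARD('n)" for v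
    using that by (intro eq_vecI) (simp_all add: from_jnf_def to_jnf_def enum_inv_into)
  have to_jnf_carrier: "to_jnf w \<in> carrier_vec CARD('n)" for w
    by (simp add: to_jnf_def)
  have mult: "complex_mat_of e A *\<^sub>v to_jnf w = to_jnf (?C *v w)" for w
  proof (rule eq_vecI)
    fix i assume "i < dim_vec (to_jnf (?C *v w))"
    then show "Matrix.vec_index (complex_mat_of e A *\<^sub>v to_jnf w) i = Matrix.vec_index (to_jnf (?C *v w)) i"
      using sum_enum[of "\<lambda>k. complex_of_real (A $ e i $ k) * w $ k"]
      by (simp add: complex_mat_of_def to_jnf_def scalar_prod_def matrix_vector_mult_def atLeast0LessThan)
  qed (simp add: complex_mat_of_def to_jnf_def)
  have smult: "z \<cdot>\<^sub>v to_jnf w = to_jnf (z *s w)" for w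
    by (intro eq_vecI) (simp_all add: to_jnf_def)
  have to_jnf_eq: "to_jnf w = to_jnf w' \<longleftrightarrow> w = w'" for w w'
    by (metis of_to)
  have zero: "0\<^sub>v CARD('n) = to_jnf 0"
    by (intro eq_vecI) (simp_all add: to_jnf_def)
  have "eigenvalue (complex_mat_of e A) z \<longleftrightarrow> (\<exists>w. to_jnf w \<noteq> 0\<^sub>v CARD('n) \<and>
      complex_mat_of e A *\<^sub>v to_jnf w = z \<cdot>\<^sub>v to_jnf w)"
    unfolding eigenvalue_def eigenvector_def
    by (metis complex_mat_of_carrier carrier_matD(1) to_of to_jnf_carrier)
  also have "\<dots> \<longleftrightarrow> cx_eigenvalue A z"
    by (simp add: cx_eigenvalue_def mult smult zero to_jnf_eq)
  finally show ?thesis .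
qed

lemma spectral_radius_complex_mat_of:
  "Defs.spectral_radius A = Spectral_Radius.spectral_radius (complex_mat_of e A)"
proof -
  have "{cmod z | z. cx_eigenvalue A z} = norm ` Spectral_Radius.spectrum (complex_mat_of e A)"
    by (auto simp: Spectral_Radius.spectrum_def eigenvalue_complex_mat_of_iff)
  then show ?thesis
    by (simp add: Defs.spectral_radius_def Spectral_Radius.spectral_radius_def)
qed

end

lemma enumerationE:
  obtains e :: "nat \<Rightarrow> 'n::finite" where "bij_betw e {..<CARD('n)} UNIV"
  using ex_bij_betw_nat_finite[of "UNIV :: 'n set"] by (auto simp: atLeast0LessThan)

lemma cx_eigenvalue_le_spectral_radius:
  fixes A :: "real^'n::finite^'n"
  assumes "cx_eigenvalue A z"
  shows "cmod z \<le> Defs.spectral_radius A"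
proof -
  obtain e :: "nat \<Rightarrow> 'n" where e: "bij_betw e {..<CARD('n)} UNIV"
    by (rule enumerationE)
  with assms show ?thesis
    by (simp add: spectral_radius_complex_mat_of spectral_radius_mem_max(2)[OF complex_mat_of_carrier]
      Spectral_Radius.spectrum_def eigenvalue_complex_mat_of_iff)
qed

lemma spectral_radius_attained:
  fixes A :: "real^'n::finite^'n"
  obtains z where "cx_eigenvalue A z" "cmod z = Defs.spectral_radius A"
proof -
  obtain e :: "nat \<Rightarrow> 'n" where e: "bij_betw e {..<CARD('n)} UNIV"
    by (rule enumerationE)
  from spectral_radius_mem_max(1)[OF complex_mat_of_carrier, of e A] that show thesis
    by (auto simp: spectral_radius_complex_mat_of[OF e] Spectral_Radius.spectrum_def
        eigenvalue_complex_mat_of_iff[OF e])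
qed

lemma cx_eigenvalue_scaleR:
  assumes "cx_eigenvalue A z"
  shows "cx_eigenvalue (c *\<^sub>R A) (complex_of_real c * z)"
proof -
  obtain v where v: "v \<noteq> 0" "(\<chi> i j. complex_of_real (A $ i $ j)) *v v = z *s v"
    using assms unfolding cx_eigenvalue_def by blast
  have "(\<chi> i j. complex_of_real ((c *\<^sub>R A) $ i $ j)) *v v
      = complex_of_real c *s ((\<chi> i j. complex_of_real (A $ i $ j)) *v v)"
    by (simp add: Finite_Cartesian_Product.vec_eq_iff matrix_vector_mult_def sum_distrib_left
        mult.assoc)
  with v show ?thesis
    unfolding cx_eigenvalue_def by (auto simp: vector_smult_assoc)
qed

lemma matpow_entries_bounded:
  fixes A :: "real^'n::finite^'n"
  assumes "Defs.spectral_radius A < 1"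
  obtains c where "\<And>k i j. \<bar>matpow A k $ i $ j\<bar> \<le> c"
proof -
  obtain e :: "nat \<Rightarrow> 'n" where e: "bij_betw e {..<CARD('n)} UNIV"
    by (rule enumerationE)
  have "Spectral_Radius.spectral_radius (complex_mat_of e A) < 1"
    using assms by (simp add: spectral_radius_complex_mat_of[OF e])
  then obtain c where c: "\<And>k. norm_bound (complex_mat_of e A ^\<^sub>m k) c"
    using spectral_radius_jnf_norm_bound_less_1_upper_triangular[OF complex_mat_of_carrier] by blast
  have "\<bar>matpow A k $ i $ j\<bar> \<le> c" for k i j
  proof -
    have "x \<in> e ` {..<CARD('n)}" for x
      using e by (simp add: bij_betw_def)
    then obtain i' j' where ij: "i' < CARD('n)" "j' < CARD('n)" "e i' = i" "e j' = j"
      by (metis imageE lessThan_iff)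
    have "norm ((complex_mat_of e A ^\<^sub>m k) $$ (i', j')) \<le> c"
      using c[of k] ij(1,2) unfolding norm_bound_def by simp
    then have "norm (complex_mat_of e (matpow A k) $$ (i', j')) \<le> c"
      by (simp only: complex_mat_of_matpow[OF e])
    with ij show ?thesis
      by (simp add: complex_mat_of_def)
  qed
  then show thesis by (rule that)
qed

text \<open>For \<open>\<rho>(A) < r < 1\<close> the matrix \<open>A / r\<close> still has spectral radius below one, so its
  powers are bounded by the Jordan normal form; this bound costs only the factor \<open>r^k\<close>.\<close>
lemma spectral_radius_less_1_imp_exp_stable:
  fixes A :: "real^'n::finite^'n"
  assumes "Defs.spectral_radius A < 1"
  shows "uniformly_exp_stable {A}"
proof -
  define r where "r = (Defs.spectral_radius A + 1) / 2"
  obtain z0 where "cmod z0 = Defs.spectral_radius A"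
    using spectral_radius_attained by blast
  then have r: "0 < r" "r < 1" "Defs.spectral_radius A < r"
    using assms norm_ge_zero[of z0] unfolding r_def by auto
  define B where "B = (1 / r) *\<^sub>R A"
  have A_eq: "A = r *\<^sub>R B"
    using r by (simp add: B_def)
  have "Defs.spectral_radius B < 1"
  proof -
    obtain z where z: "cx_eigenvalue B z" "cmod z = Defs.spectral_radius B"
      by (rule spectral_radius_attained)
    have "r * cmod z \<le> Defs.spectral_radius A"
      using cx_eigenvalue_le_spectral_radius[OF cx_eigenvalue_scaleR[OF z(1), of r]] r
      by (simp add: A_eq norm_mult)
    with r z(2) show ?thesis
      by (metis mult_less_cancel_left_pos mult.right_neutral order.strict_trans1)
  qed
  then obtain c where c: "\<And>k i j. \<bar>matpow B k $ i $ j\<bar> \<le> c"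
    using matpow_entries_bounded by metis
  have "\<bar>matpow A k $ i $ j\<bar> \<le> c * r ^ k" for k i j
  proof -
    have "\<bar>matpow A k $ i $ j\<bar> = r ^ k * \<bar>matpow B k $ i $ j\<bar>"
      using r by (simp add: A_eq matpow_scaleR abs_mult)
    also have "\<dots> \<le> r ^ k * c"
      using c r by (simp add: mult_left_mono)
    finally show ?thesis
      by (simp add: mult.commute)
  qed
  then have "onorm ((*v) (matpow A k)) \<le> (real CARD('n) * real CARD('n) * c) * r ^ k" for k
    using onorm_le_matrix_component[of "matpow A k" "c * r ^ k"] by (simp add: mult.assoc)
  with r show ?thesis
    unfolding uniformly_exp_stable_def by blast
qed

section \<open>Continuous branches of solutions\<close>

definition solution_graph_on ::
  "('p::topological_space \<Rightarrow> 'x::topological_space \<Rightarrow> bool) \<Rightarrow> 'p set \<Rightarrow> 'x set \<Rightarrow> ('p \<Rightarrow> 'x) \<Rightarrow> bool"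
where
  "solution_graph_on F P B g \<longleftrightarrow>
     continuous_on P g \<and> (\<forall>p\<in>P. g p \<in> B \<and> F p (g p)) \<and> (\<forall>p\<in>P. \<forall>x\<in>B. F p x \<longrightarrow> x = g p)"

definition local_solution_graph :: "('p::topological_space \<Rightarrow> 'x::topological_space \<Rightarrow> bool) \<Rightarrow> 'p \<Rightarrow> 'x \<Rightarrow> bool" where
  "local_solution_graph F p0 x0 \<longleftrightarrow>
     (\<exists>P B g. open P \<and> open B \<and> p0 \<in> P \<and> x0 \<in> B \<and> solution_graph_on F P B g)"

lemma solution_graph_on_subset:
  "solution_graph_on F P B g \<Longrightarrow> P' \<subseteq> P \<Longrightarrow> solution_graph_on F P' B g"
  unfolding solution_graph_on_def by (blast intro: continuous_on_subset)

lemma local_solution_graph_compose: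
  assumes "local_solution_graph F (\<Lambda> s0) x0" and "continuous_on UNIV \<Lambda>"
  shows "local_solution_graph (\<lambda>s. F (\<Lambda> s)) s0 x0"
proof -
  obtain P B g where PB: "open P" "open B" "\<Lambda> s0 \<in> P" "x0 \<in> B" and g: "solution_graph_on F P B g"
    using assms(1) unfolding local_solution_graph_def by blast
  have "open (\<Lambda> -` P)"
    using continuous_open_preimage[OF assms(2) open_UNIV \<open>open P\<close>] by simp
  moreover have "continuous_on (\<Lambda> -` P) (g \<circ> \<Lambda>)"
  proof (rule continuous_on_compose)
    show "continuous_on (\<Lambda> -` P) \<Lambda>"
      using assms(2) by (rule continuous_on_subset) simp
    show "continuous_on (\<Lambda> ` (\<Lambda> -` P)) g"
      using g unfolding solution_graph_on_def by (blast intro: continuous_on_subset)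
  qed
  ultimately show ?thesis
    using PB g unfolding local_solution_graph_def solution_graph_on_def
    by (intro exI[of _ "\<Lambda> -` P"] exI[of _ B] exI[of _ "g \<circ> \<Lambda>"]) auto
qed

text \<open>Uniqueness in the box \<open>P \<times> B\<close> propagates along connected sets: the set where a
  continuous solution \<open>b\<close> agrees with \<open>g\<close> is \<open>b\<^sup>-\<^sup>1(B)\<close>, hence both open and closed.\<close>
lemma solution_graph_on_agree:
  fixes b g :: "'p::topological_space \<Rightarrow> 'x::metric_space"
  assumes g: "solution_graph_on F P B g" "open B"
    and J: "connected J" "J \<subseteq> P" and b: "continuous_on J b" "\<And>u. u \<in> J \<Longrightarrow> F u (b u)"
    and t: "t \<in> J" "b t = g t" and u: "u \<in> J"
  shows "b u = g u"
proof -
  have eq: "{u \<in> J. dist (b u) (g u) = 0} = J \<inter> b -` B"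
    using g J b unfolding solution_graph_on_def by auto
  have "continuous_on J g"
    using g(1) J(2) unfolding solution_graph_on_def by (blast intro: continuous_on_subset)
  then have "closedin (top_of_set J) (J \<inter> b -` B)"
    unfolding eq[symmetric] by (intro continuous_closedin_preimage_constant continuous_on_dist b)
  moreover have "openin (top_of_set J) (J \<inter> b -` B)"
    by (rule continuous_openin_preimage_gen[OF b(1) g(2)])
  moreover have "t \<in> J \<inter> b -` B"
    using eq t g(1) J(2) unfolding solution_graph_on_def by auto
  ultimately have "J \<inter> b -` B = J"
    using J(1) unfolding connected_clopen by blast
  with eq u show ?thesis
    by auto
qed

definition branch_reaches :: "(real \<Rightarrow> 'x::topological_space \<Rightarrow> bool) \<Rightarrow> real \<Rightarrow> 'x \<Rightarrow> real \<Rightarrow> 'x \<Rightarrow> bool" where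
  "branch_reaches F s x t y \<longleftrightarrow>
     (\<exists>b. continuous_on (closed_segment s t) b \<and> (\<forall>u\<in>closed_segment s t. F u (b u)) \<and> b s = x \<and> b t = y)"

lemma branch_reaches_refl: "F s x \<Longrightarrow> branch_reaches F s x s x"
  unfolding branch_reaches_def by (intro exI[of _ "\<lambda>_. x"]) simp

lemma branch_reaches_along_graph:
  fixes g :: "real \<Rightarrow> 'x::metric_space"
  assumes g: "solution_graph_on F P B g" "open B" "convex P"
    and t: "t \<in> P" "t' \<in> P" and reach: "branch_reaches F s x t (g t)"
  shows "branch_reaches F s x t' (g t')"
proof -
  obtain b where b: "continuous_on (closed_segment s t) b" "\<And>u. u \<in> closed_segment s t \<Longrightarrow> F u (b u)"
    "b s = x" "b t = g t"
    using reach unfolding branch_reaches_def by blast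
  define J1 J2 where "J1 = closed_segment s t" and "J2 = closed_segment t t'"
  have J2: "J2 \<subseteq> P"
    unfolding J2_def using g(3) t by (simp add: closed_segment_subset)
  have "connected (J1 \<inter> J2)"
    unfolding J1_def J2_def by (intro convex_connected convex_Int convex_closed_segment)
  moreover have "continuous_on (J1 \<inter> J2) b"
    using b(1) unfolding J1_def by (rule continuous_on_subset) simp
  moreover have "J1 \<inter> J2 \<subseteq> P"
    using J2 by blast
  ultimately have agree: "b u = g u" if "u \<in> J1 \<inter> J2" for u
    using solution_graph_on_agree[OF g(1,2), of "J1 \<inter> J2" b t u] that b(2,4)
    unfolding J1_def J2_def by simp
  define b' where "b' u = (if u \<in> J2 then g u else b u)" for u
  have cont: "continuous_on (J1 \<union> J2) b'"
  proof (rule continuous_on_closed_Un)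
    show "continuous_on J1 b'"
      by (rule continuous_on_eq[OF b(1)[folded J1_def]]) (simp add: b'_def agree)
    have "continuous_on J2 g"
      using g(1) J2 unfolding solution_graph_on_def by (blast intro: continuous_on_subset)
    then show "continuous_on J2 b'"
      by (rule continuous_on_eq) (simp add: b'_def)
  qed (simp_all add: J1_def J2_def)
  have seg: "closed_segment s t' \<subseteq> J1 \<union> J2"
    unfolding J1_def J2_def by (auto simp: closed_segment_eq_real_ivl split: if_splits)
  have "F u (b' u)" if "u \<in> J1 \<union> J2" for u
    using that b(2) g(1) J2 unfolding b'_def J1_def solution_graph_on_def by auto
  moreover have "b' s = x" "b' t' = g t'"
    using agree b(3) unfolding b'_def J1_def J2_def by auto
  ultimately show ?thesis
    unfolding branch_reaches_def using continuous_on_subset[OF cont seg] seg by blast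
qed

lemma local_solution_graphE:
  fixes F :: "'p::metric_space \<Rightarrow> 'x::topological_space \<Rightarrow> bool"
  assumes "local_solution_graph F p0 x0" and "F p0 x0"
  obtains \<delta> B g where "\<delta> > 0" "open B" "x0 \<in> B" "solution_graph_on F (ball p0 \<delta>) B g" "g p0 = x0"
proof -
  obtain P B g where PB: "open P" "open B" "p0 \<in> P" "x0 \<in> B" and g: "solution_graph_on F P B g"
    using assms(1) unfolding local_solution_graph_def by blast
  obtain \<delta> where \<delta>: "\<delta> > 0" "ball p0 \<delta> \<subseteq> P"
    using PB open_contains_ball_eq by blast
  have "g p0 = x0"
    using g PB(3,4) assms(2) unfolding solution_graph_on_def by simp
  then show thesis
    by (rule that[OF \<delta>(1) PB(2,4) solution_graph_on_subset[OF g \<delta>(2)]])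
qed

lemma branch_reaches_locally_constant:
  fixes X :: "real \<Rightarrow> 'x::metric_space"
  assumes sol: "\<And>s. F s (X s)" and loc: "local_solution_graph F t0 (X t0)"
  shows "\<exists>T. openin (top_of_set (range (\<lambda>s. (s, X s)))) T \<and> (t0, X t0) \<in> T \<and>
    (\<forall>p\<in>T. \<forall>q\<in>T. branch_reaches F s x (fst p) (snd p) \<longrightarrow> branch_reaches F s x (fst q) (snd q))"
proof -
  obtain \<delta> B g where \<delta>: "\<delta> > 0" "open B" "X t0 \<in> B" and g: "solution_graph_on F (ball t0 \<delta>) B g"
    using local_solution_graphE[OF loc sol] by metis
  define T where "T = range (\<lambda>s. (s, X s)) \<inter> (ball t0 \<delta> \<times> B)"
  have on_graph: "t \<in> ball t0 \<delta> \<and> snd p = g t" if "p \<in> T" "t = fst p" for p t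
  proof -
    have "t \<in> ball t0 \<delta>" "snd p \<in> B" "snd p = X t"
      using that unfolding T_def by auto
    with g sol[of t] show ?thesis
      unfolding solution_graph_on_def by simp
  qed
  have "branch_reaches F s x (fst q) (snd q)"
    if "p \<in> T" "q \<in> T" "branch_reaches F s x (fst p) (snd p)" for p q
  proof -
    have "branch_reaches F s x (fst p) (g (fst p))"
      using that(3) on_graph[OF that(1)] by simp
    then have "branch_reaches F s x (fst q) (g (fst q))"
      using branch_reaches_along_graph[OF g \<open>open B\<close> convex_ball] on_graph that(1,2) by blast
    then show ?thesis
      using on_graph[OF that(2)] by simp
  qed
  moreover have "openin (top_of_set (range (\<lambda>s. (s, X s)))) T"
    unfolding T_def using \<delta>(2) by (intro openin_open_Int open_Times open_ball)
  moreover have "(t0, X t0) \<in> T"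
    using \<delta> unfolding T_def by auto
  ultimately show ?thesis
    by blast
qed

lemma branch_reaches_stays_on_graph:
  fixes g :: "real \<Rightarrow> 'x::metric_space"
  assumes g: "solution_graph_on F P B g" "open B" "convex P"
    and st: "s \<in> P" "t \<in> P" and reach: "branch_reaches F s (g s) t y"
  shows "y = g t"
proof -
  obtain b where b: "continuous_on (closed_segment s t) b" "\<And>u. u \<in> closed_segment s t \<Longrightarrow> F u (b u)"
    "b s = g s" "b t = y"
    using reach unfolding branch_reaches_def by blast
  have "closed_segment s t \<subseteq> P"
    using g(3) st by (simp add: closed_segment_subset)
  then have "b t = g t"
    using solution_graph_on_agree[OF g(1,2) convex_connected[OF convex_closed_segment] _ b(1,2), of s t]
      b(3) by simp
  with b(4) show ?thesis
    by simp
qed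

text \<open>The graph of \<open>X\<close> need not be a path a priori, but continuing solution branches along
  segments reaches all of it, by connectedness.\<close>
lemma branch_reaches_connected_graph:
  fixes X :: "real \<Rightarrow> 'x::metric_space"
  assumes conn: "connected (range (\<lambda>s. (s, X s)))"
    and sol: "\<And>s. F s (X s)" and loc: "\<And>s. local_solution_graph F s (X s)"
  shows "branch_reaches F s1 (X s1) t (X t)"
proof -
  have "branch_reaches F s1 (X s1) (fst (t, X t)) (snd (t, X t))"
  proof (rule connected_induction_simple[OF conn, where P = "\<lambda>p. branch_reaches F s1 (X s1) (fst p) (snd p)"])
    show "(s1, X s1) \<in> range (\<lambda>s. (s, X s))" "(t, X t) \<in> range (\<lambda>s. (s, X s))"
      by simp_all
    show "branch_reaches F s1 (X s1) (fst (s1, X s1)) (snd (s1, X s1))"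
      using branch_reaches_refl[of F s1 "X s1"] sol by simp
  next
    fix a assume "a \<in> range (\<lambda>s. (s, X s))"
    then obtain t0 where "a = (t0, X t0)"
      by blast
    then show "\<exists>T. openin (top_of_set (range (\<lambda>s. (s, X s)))) T \<and> a \<in> T \<and>
        (\<forall>p\<in>T. \<forall>q\<in>T. branch_reaches F s1 (X s1) (fst p) (snd p) \<longrightarrow>
          branch_reaches F s1 (X s1) (fst q) (snd q))"
      using branch_reaches_locally_constant[OF sol loc[of t0]] by simp
  qed
  then show ?thesis
    by simp
qed

lemma continuous_on_if_connected_solution_graph:
  fixes X :: "real \<Rightarrow> 'x::metric_space"
  assumes conn: "connected (range (\<lambda>s. (s, X s)))"
    and sol: "\<And>s. F s (X s)" and loc: "\<And>s. local_solution_graph F s (X s)"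
  shows "continuous_on UNIV X"
proof (rule continuous_at_imp_continuous_on, intro ballI)
  fix s1 :: real
  obtain \<delta> B g where \<delta>: "\<delta> > 0" "open B" and g: "solution_graph_on F (ball s1 \<delta>) B g" "g s1 = X s1"
    using local_solution_graphE[OF loc sol] by metis
  have "X t = g t" if "t \<in> ball s1 \<delta>" for t
    using branch_reaches_stays_on_graph[OF g(1) \<delta>(2) convex_ball centre_in_ball[THEN iffD2, OF \<delta>(1)] that]
      branch_reaches_connected_graph[OF conn sol loc, of s1 t] g(2) by simp
  moreover have "continuous_on (ball s1 \<delta>) g"
    using g(1) unfolding solution_graph_on_def by blast
  ultimately have "continuous_on (ball s1 \<delta>) X"
    by (rule_tac continuous_on_eq[of _ g]) auto
  then show "isCont X s1"
    using \<delta>(1) by (simp add: continuous_on_eq_continuous_at)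
qed

section \<open>Fixed points depending on a parameter\<close>

lemma fixed_point_defect_homeomorphism:
  fixes f :: "'a::euclidean_space \<times> 'b::euclidean_space \<Rightarrow> 'a"
  assumes df: "\<And>z. (f has_derivative blinfun_apply (f' z)) (at z)" and cf: "continuous_on UNIV f'"
    and nondeg: "\<And>v. f' (x0, p0) (v, 0) = v \<Longrightarrow> v = 0"
  obtains U V G where "open U" "(x0, p0) \<in> U" "open V" "homeomorphism U V (\<lambda>z. z - (f z, 0)) G"
proof -
  define \<iota> :: "'a \<Rightarrow>\<^sub>L ('a \<times> 'b)" where "\<iota> = Blinfun (\<lambda>y. (y, 0))"
  have \<iota>: "blinfun_apply \<iota> = (\<lambda>y. (y, 0))"
    unfolding \<iota>_def by (intro bounded_linear_Blinfun_apply bounded_linear_Pair bounded_linear_ident bounded_linear_zero)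
  define F' where "F' z = id_blinfun - (\<iota> o\<^sub>L f' z)" for z
  have F'_apply: "F' z h = h - (f' z h, 0)" for z h
    by (simp add: F'_def \<iota> blinfun.diff_left)
  have dF: "((\<lambda>z. z - (f z, 0)) has_derivative blinfun_apply (F' z)) (at z)" for z
    by (rule has_derivative_eq_rhs[OF has_derivative_diff[OF has_derivative_ident
          has_derivative_Pair[OF df has_derivative_const]]]) (simp add: F'_apply fun_eq_iff)
  have cF': "continuous_on UNIV F'"
    unfolding F'_def by (intro continuous_intros cf)
  have "inj (blinfun_apply (F' (x0, p0)))"
    unfolding linear_injective_0[OF bounded_linear.linear[OF blinfun.bounded_linear_right]]
  proof (intro allI impI)
    fix h :: "'a \<times> 'b" assume "F' (x0, p0) h = 0"
    then have "snd h = 0" "fst h = f' (x0, p0) h"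
      by (auto simp: F'_apply prod_eq_iff)
    moreover from this have "f' (x0, p0) (fst h, 0) = fst h"
      by (metis prod.collapse)
    ultimately show "h = 0"
      using nondeg by (simp add: prod_eq_iff)
  qed
  then obtain g where g: "linear g" "g \<circ> blinfun_apply (F' (x0, p0)) = id"
    using linear_injective_left_inverse[OF bounded_linear.linear[OF blinfun.bounded_linear_right]]
    by blast
  have inv: "Blinfun g o\<^sub>L F' (x0, p0) = id_blinfun"
    using g by (intro blinfun_eqI) (simp add: bounded_linear_Blinfun_apply linear_conv_bounded_linear
        pointfree_idE)
  show thesis
    by (rule inverse_function_theorem[OF open_UNIV dF cF' UNIV_I inv], rule that; assumption)
qed


lemma fixed_points_from_defect_inverse:
  fixes f :: "'a::real_normed_vector \<times> 'b::real_normed_vector \<Rightarrow> 'a"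
  assumes hom: "homeomorphism U V (\<lambda>z. z - (f z, 0)) G"
  shows "(0, p) \<in> V \<Longrightarrow> G (0, p) = (fst (G (0, p)), p) \<and> f (G (0, p)) = fst (G (0, p))"
    and "(x, p) \<in> U \<Longrightarrow> f (x, p) = x \<Longrightarrow> G (0, p) = (x, p)"
proof -
  show "G (0, p) = (fst (G (0, p)), p) \<and> f (G (0, p)) = fst (G (0, p))" if "(0, p) \<in> V"
    using homeomorphism_apply2[OF hom that] by (cases "G (0, p)") simp
  show "G (0, p) = (x, p)" if "(x, p) \<in> U" "f (x, p) = x"
    using homeomorphism_apply1[OF hom that(1)] that(2) by simp
qed

text \<open>Implicit function theorem for fixed points: if \<open>1\<close> is not an eigenvalue of the partial
  derivative \<open>D\<^sub>x f (x\<^sub>0, p\<^sub>0)\<close>, the fixed points of \<open>f(\<cdot>, p)\<close> near \<open>x\<^sub>0\<close> form a continuous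
  graph over \<open>p\<close> near \<open>p\<^sub>0\<close>, namely the first component of the local inverse of the defect map
  along \<open>{0} \<times> P\<close>.\<close>
lemma fixed_point_local_solution_graph:
  fixes f :: "'a::euclidean_space \<times> 'b::euclidean_space \<Rightarrow> 'a"
  assumes df: "\<And>z. (f has_derivative blinfun_apply (f' z)) (at z)" and cf: "continuous_on UNIV f'"
    and fix0: "f (x0, p0) = x0" and nondeg: "\<And>v. f' (x0, p0) (v, 0) = v \<Longrightarrow> v = 0"
  shows "local_solution_graph (\<lambda>p x. f (x, p) = x) p0 x0"
proof -
  obtain U V G where U: "open U" "(x0, p0) \<in> U" and "open V"
    and hom: "homeomorphism U V (\<lambda>z. z - (f z, 0)) G"
    by (rule fixed_point_defect_homeomorphism[OF df cf nondeg])
  note fixed = fixed_points_from_defect_inverse[OF hom]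
  have "(0, p0) \<in> V"
    using homeomorphism_image1[OF hom] U(2) fix0 by force
  obtain A1 B1 where "open A1" "open B1" "(x0, p0) \<in> A1 \<times> B1" "A1 \<times> B1 \<subseteq> U"
    by (rule open_prod_elim[OF U])
  then have A1B1: "open A1" "open B1" "x0 \<in> A1" "p0 \<in> B1" "A1 \<times> B1 \<subseteq> U"
    by simp_all
  obtain A2 B2 where "open A2" "open B2" "(0, p0) \<in> A2 \<times> B2" "A2 \<times> B2 \<subseteq> V"
    by (rule open_prod_elim[OF \<open>open V\<close> \<open>(0, p0) \<in> V\<close>])
  then have B2: "open B2" "p0 \<in> B2" "\<And>p. p \<in> B2 \<Longrightarrow> (0, p) \<in> V"
    by auto
  define g where "g p = fst (G (0, p))" for p
  have "continuous_on B2 (\<lambda>p. G (0, p))"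
    using B2 by (intro continuous_on_compose2[OF homeomorphism_cont2[OF hom]] continuous_intros) auto
  then have "continuous_on B2 g"
    unfolding g_def by (rule continuous_on_fst)
  have "g p0 = x0"
    using fixed(2)[OF U(2) fix0] by (simp add: g_def)
  define P where "P = (B1 \<inter> B2) \<inter> g -` A1"
  have "open P"
    unfolding P_def using continuous_on_subset[OF \<open>continuous_on B2 g\<close>, of "B1 \<inter> B2"] A1B1 B2
    by (intro continuous_open_preimage) auto
  have "solution_graph_on (\<lambda>p x. f (x, p) = x) P A1 g"
    unfolding solution_graph_on_def
  proof (intro conjI ballI impI)
    show "continuous_on P g"
      using \<open>continuous_on B2 g\<close> by (rule continuous_on_subset) (auto simp: P_def)
  next
    fix p assume "p \<in> P"
    then have "p \<in> B2" "g p \<in> A1"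
      by (simp_all add: P_def)
    moreover from this have "G (0, p) = (g p, p)" "f (G (0, p)) = g p"
      using fixed(1)[OF B2(3)] by (simp_all add: g_def)
    ultimately show "g p \<in> A1" "f (g p, p) = g p"
      by simp_all
  next
    fix p x assume "p \<in> P" "x \<in> A1" "f (x, p) = x"
    then have "(x, p) \<in> U"
      using A1B1(5) by (auto simp: P_def)
    with \<open>f (x, p) = x\<close> show "x = g p"
      using fixed(2) by (simp add: g_def)
  qed
  moreover have "p0 \<in> P"
    using A1B1 B2 \<open>g p0 = x0\<close> by (simp add: P_def)
  ultimately show ?thesis
    unfolding local_solution_graph_def using \<open>open P\<close> \<open>open A1\<close> \<open>x0 \<in> A1\<close>
    by (intro exI[of _ P] exI[of _ A1] exI[of _ g]) simp
qed

lemma Dx_mult: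
  fixes f :: "(real^'l::finite) \<times> (real^'m::finite) \<Rightarrow> real^'l"
  assumes "(f has_derivative blinfun_apply (f' (x, p))) (at (x, p))"
  shows "Dx f x p *v v = f' (x, p) (v, 0)"
proof -
  have d: "((\<lambda>y. f (y, p)) has_derivative (\<lambda>v. f' (x, p) (v, 0))) (at x)"
    using diff_chain_at[OF has_derivative_Pair[OF has_derivative_ident has_derivative_const] assms]
    by (simp add: o_def)
  have "(\<lambda>v. Dx f x p *v v) = (\<lambda>v. f' (x, p) (v, 0))"
    unfolding Dx_def frechet_derivative_at[OF d, symmetric]
    by (rule matrix_vector_mul(3)[OF has_derivative_bounded_linear[OF d]])
  then show ?thesis
    by (rule fun_cong)
qed

lemma continuous_on_Dx:
  fixes f :: "(real^'l::finite) \<times> (real^'m::finite) \<Rightarrow> real^'l"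
  assumes df: "\<And>z. (f has_derivative blinfun_apply (f' z)) (at z)" and cf: "continuous_on UNIV f'"
  shows "continuous_on UNIV (\<lambda>z. Dx f (fst z) (snd z))"
proof -
  have "Dx f (fst z) (snd z) = matrix (\<lambda>v. f' z (v, 0))" for z
  proof -
    have "(\<lambda>v. Dx f (fst z) (snd z) *v v) = (\<lambda>v. f' z (v, 0))"
      using Dx_mult[of f f' "fst z" "snd z"] df[of z] by simp
    then show ?thesis
      by (metis matrix_of_matrix_vector_mul)
  qed
  then have "(\<lambda>z. Dx f (fst z) (snd z)) = (\<lambda>z. \<chi> i j. f' z (axis j 1, 0) $ i)"
    by (simp add: matrix_def)
  then show ?thesis
    by (simp only:) (intro continuous_on_vec_lambda continuous_on_component blinfun.continuous_on cf
        continuous_on_const)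
qed

lemma parameter_shift_continuous: "parameter_shift \<Lambda> lm lp \<Longrightarrow> continuous_on UNIV \<Lambda>"
  unfolding parameter_shift_def
  by (metis continuous_at_imp_continuous_on has_vector_derivative_continuous)

lemma stable_path_continuous:
  fixes f :: "(real^'l::finite) \<times> (real^'m::finite) \<Rightarrow> real^'l"
  assumes "C1 f" and "parameter_shift \<Lambda> lm lp" and "stable_path f \<Lambda> lm lp X"
  shows "continuous_on UNIV X"
proof -
  obtain f' where df: "\<And>z. (f has_derivative blinfun_apply (f' z)) (at z)" and cf: "continuous_on UNIV f'"
    using assms(1) unfolding C1_def by blast
  have \<Lambda>: "continuous_on UNIV \<Lambda>"
    using assms(2) by (rule parameter_shift_continuous)
  have fixX: "\<And>s. f (X s, \<Lambda> s) = X s" and conn: "connected (range (\<lambda>s. (s, X s)))"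
    and stable: "\<And>s. uniformly_exp_stable {Dx f (X s) (\<Lambda> s)}"
    using assms(3) spectral_radius_less_1_imp_exp_stable unfolding stable_path_def by blast+
  have "local_solution_graph (\<lambda>s x. f (x, \<Lambda> s) = x) s (X s)" for s
  proof (rule local_solution_graph_compose[OF _ \<Lambda>])
    have "v = 0" if "f' (X s, \<Lambda> s) (v, 0) = v" for v
      using uniformly_exp_stable_fixed_vector[OF stable] Dx_mult[of f f' "X s" "\<Lambda> s"] df that by metis
    then show "local_solution_graph (\<lambda>p x. f (x, p) = x) (\<Lambda> s) (X s)"
      by (rule fixed_point_local_solution_graph[OF df cf fixX])
  qed
  then show ?thesis
    by (rule continuous_on_if_connected_solution_graph[where F = "\<lambda>s x. f (x, \<Lambda> s) = x", OF conn fixX])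
qed

lemma stable_path_uniformly_exp_stable:
  fixes f :: "(real^'l::finite) \<times> (real^'m::finite) \<Rightarrow> real^'l"
  assumes "C1 f" and "parameter_shift \<Lambda> lm lp" and "stable_path f \<Lambda> lm lp X"
  shows "uniformly_exp_stable (range (\<lambda>s. Dx f (X s) (\<Lambda> s)))"
proof -
  define D where "D z = Dx f (fst z) (snd z)" for z
  have D: "continuous_on UNIV D"
    using assms(1) continuous_on_Dx unfolding C1_def D_def by blast
  obtain Xm Xp where X: "(X \<longlongrightarrow> Xm) at_bot" "(X \<longlongrightarrow> Xp) at_top"
    and stable_lim: "Defs.spectral_radius (Dx f Xm lm) < 1" "Defs.spectral_radius (Dx f Xp lp) < 1"
    and stable: "\<And>s. Defs.spectral_radius (Dx f (X s) (\<Lambda> s)) < 1"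
    using assms(3) unfolding stable_path_def by blast
  have \<Lambda>: "(\<Lambda> \<longlongrightarrow> lm) at_bot" "(\<Lambda> \<longlongrightarrow> lp) at_top" "continuous_on UNIV \<Lambda>"
    using assms(2) parameter_shift_continuous unfolding parameter_shift_def by blast+
  let ?A = "\<lambda>s. D (X s, \<Lambda> s)"
  have cont: "continuous_on UNIV ?A"
    using D stable_path_continuous[OF assms] \<Lambda>(3) by (intro continuous_on_compose2[OF D] continuous_intros) auto
  have lim: "(?A \<longlongrightarrow> D (Xm, lm)) at_bot" "(?A \<longlongrightarrow> D (Xp, lp)) at_top"
    using X \<Lambda> by (auto intro!: continuous_on_tendsto_compose[OF D] tendsto_Pair)
  have "uniformly_exp_stable (range ?A)"
    using stable_lim stable
    by (intro uniformly_exp_stable_range[OF cont lim] spectral_radius_less_1_imp_exp_stable)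
      (simp_all add: D_def)
  then show ?thesis
    by (simp add: D_def)
qed

theorem mainTheorem9:
  fixes f :: "(real^'l) \<times> (real^'m) \<Rightarrow> real^'l"
    and \<Lambda> :: "real \<Rightarrow> real^'m" and lm lp :: "real^'m"
    and X :: "real \<Rightarrow> real^'l"
  assumes "C1 f"
    and "parameter_shift \<Lambda> lm lp"
    and "stable_path f \<Lambda> lm lp X"
  shows "\<exists>\<kappa> c. \<kappa> > 0 \<and> 0 < c \<and> c < 1 \<and>
           (\<forall>s. \<forall>n::nat. onorm (\<lambda>v. matpow (Dx f (X s) (\<Lambda> s)) n *v v) < \<kappa> * c ^ n)"
proof -
  obtain K c where c: "0 < c" "c < 1"
    and K: "\<And>s n. onorm ((*v) (matpow (Dx f (X s) (\<Lambda> s)) n)) \<le> K * c ^ n"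
    using stable_path_uniformly_exp_stable[OF assms] unfolding uniformly_exp_stable_def by auto
  have "K * c ^ n < (\<bar>K\<bar> + 1) * c ^ n" for n
    using c by (intro mult_strict_right_mono) auto
  then have "onorm (\<lambda>v. matpow (Dx f (X s) (\<Lambda> s)) n *v v) < (\<bar>K\<bar> + 1) * c ^ n" for s n
    using K[of s n] by (simp add: le_less_trans)
  with c show ?thesis
    by (intro exI[of _ "\<bar>K\<bar> + 1"] exI[of _ c]) simp
qed

end
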